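(* Let $G$ be a group acting on a field $L$ by automorphisms, let $K\subseteq L^G$ be a subring, and let $R=K[a_1,\dots,a_n]\subseteq L$ be a finitely generated $G$-stable $K$-subalgebra with $\operatorname{Quot}(R)=L$. Let $E\subseteq L[y_1,\dots,y_n]$ be an extended Derksen ideal with respect to $a_1,\dots,a_n$. Let $\mathcal G$ be a reduced Gr\"obner basis of $E$ with respect to an arbitrary monomial ordering, and let $A\subseteq L$ be the $K$-subalgebra generated by the coefficients of all polynomials from $\mathcal G$. Then $R^G\subseteq A\subseteq L^G$. If there exists a nonzero invariant $a\in R^G$ with $A\subseteq R_a:=R[a^{-1}]$, then \[ R^G_a=A_a. \]
   Context: Rings are commutative with identity. $\operatorname{Quot}$ denotes the field of fractions. For a subring $B\subseteq L$ and $0\ne a\in B$, $B_a:=B[a^{-1}]\subseteq L$; $R^G_a:=(R^G)[a^{-1}]$. $G$ acts on $L[y_1,\dots,y_n]$ coefficient-wise, fixing the indeterminates $y_i$. Reduced Gr\"obner bases consist of monic polynomials. The Derksen ideal with respect to $a_1,\dots,a_n$ is $D_{a_1,\dots,a_n}:=\bigcap_{\sigma\in G}(y_1-\sigma\cdot a_1,\dots,y_n-\sigma\cdot a_n)\subseteq L[y_1,\dots,y_n]$. An extended Derksen ideal (with respect to $a_1,\dots,a_n$) is a proper $G$-stable ideal $E\subsetneqq L[y_1,\dots,y_n]$ containing $D_{a_1,\dots,a_n}$. *)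

theory Defs
  imports Complex_Main "HOL.Hull" "HOL-Library.Poly_Mapping" "HOL-Algebra.Group_Action"
begin

definition is_subring :: "'a::ring_1 set \<Rightarrow> bool" where
  "is_subring B \<longleftrightarrow> 0 \<in> B \<and> 1 \<in> B \<and>
     (\<forall>x\<in>B. \<forall>y\<in>B. x + y \<in> B) \<and> (\<forall>x\<in>B. - x \<in> B) \<and> (\<forall>x\<in>B. \<forall>y\<in>B. x * y \<in> B)"

text \<open>For a subring \<open>K\<close>, the subalgebra \<open>K[S]\<close> is the smallest subring containing \<open>K\<close> and \<open>S\<close>.\<close>

definition subalgebra_gen :: "'a::ring_1 set \<Rightarrow> 'a set \<Rightarrow> 'a set" where
  "subalgebra_gen K S = is_subring hull (K \<union> S)"

text \<open>\<open>B[a\<inverse>]\<close>, formed inside the ambient field; only meaningful for \<open>a \<noteq> 0\<close>.\<close>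

definition localize :: "'a::field set \<Rightarrow> 'a \<Rightarrow> 'a set" where
  "localize B a = subalgebra_gen B {inverse a}"

text \<open>The field of fractions, as a subfield of the ambient field.\<close>

definition Quot :: "'a::field set \<Rightarrow> 'a set" where
  "Quot B = {b / c | b c. b \<in> B \<and> c \<in> B \<and> c \<noteq> 0}"

definition acts_by_field_automorphisms ::
    "('g, 'm) monoid_scheme \<Rightarrow> ('g \<Rightarrow> 'a::field \<Rightarrow> 'a) \<Rightarrow> bool" where
  "acts_by_field_automorphisms G \<phi> \<longleftrightarrow> group_action G UNIV \<phi> \<and>
     (\<forall>\<sigma>\<in>carrier G. \<forall>x y. \<phi> \<sigma> (x + y) = \<phi> \<sigma> x + \<phi> \<sigma> y \<and> \<phi> \<sigma> (x * y) = \<phi> \<sigma> x * \<phi> \<sigma> y)"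

definition stable_under :: "('g, 'm) monoid_scheme \<Rightarrow> ('g \<Rightarrow> 'b \<Rightarrow> 'b) \<Rightarrow> 'b set \<Rightarrow> bool" where
  "stable_under G \<phi> B \<longleftrightarrow> (\<forall>\<sigma>\<in>carrier G. \<phi> \<sigma> ` B \<subseteq> B)"

definition invariant_elements :: "('g, 'm) monoid_scheme \<Rightarrow> ('g \<Rightarrow> 'b \<Rightarrow> 'b) \<Rightarrow> 'b set \<Rightarrow> 'b set" where
  "invariant_elements G \<phi> B = {x \<in> B. \<forall>\<sigma>\<in>carrier G. \<phi> \<sigma> x = x}"

text \<open>Monomials are exponent vectors; the finite type \<open>'n\<close> indexes the indeterminates, so that
  \<open>('n, 'a) mpoly\<close> is the polynomial ring in \<open>CARD('n)\<close> indeterminates over \<open>'a\<close>.\<close>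

type_synonym 'n monomial = "'n \<Rightarrow>\<^sub>0 nat"
type_synonym ('n, 'a) mpoly = "'n monomial \<Rightarrow>\<^sub>0 'a"

definition MVar :: "'n \<Rightarrow> ('n, 'a::field) mpoly" where
  "MVar i = Poly_Mapping.single (Poly_Mapping.single i 1) 1"

definition MConst :: "'a::field \<Rightarrow> ('n, 'a) mpoly" where
  "MConst c = Poly_Mapping.single 0 c"

text \<open>An ideal of a commutative ring is a submodule of the ring over itself.\<close>

lemma module_times: "module ((*) :: 'r::comm_ring_1 \<Rightarrow> 'r \<Rightarrow> 'r)"
  by unfold_locales (simp_all add: algebra_simps)

abbreviation is_ideal :: "'r::comm_ring_1 set \<Rightarrow> bool" where
  "is_ideal \<equiv> module.subspace (*)"

abbreviation ideal_gen :: "'r::comm_ring_1 set \<Rightarrow> 'r set" where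
  "ideal_gen \<equiv> module.span (*)"

definition coeff_action :: "('g \<Rightarrow> 'a::field \<Rightarrow> 'a) \<Rightarrow> 'g \<Rightarrow> ('n, 'a) mpoly \<Rightarrow> ('n, 'a) mpoly" where
  "coeff_action \<phi> \<sigma> p = Poly_Mapping.map (\<phi> \<sigma>) p"

definition derksen_ideal ::
    "('g, 'm) monoid_scheme \<Rightarrow> ('g \<Rightarrow> 'a::field \<Rightarrow> 'a) \<Rightarrow> ('n \<Rightarrow> 'a) \<Rightarrow> ('n, 'a) mpoly set" where
  "derksen_ideal G \<phi> a = (\<Inter>\<sigma>\<in>carrier G. ideal_gen (range (\<lambda>i. MVar i - MConst (\<phi> \<sigma> (a i)))))"

definition extended_derksen_ideal ::
    "('g, 'm) monoid_scheme \<Rightarrow> ('g \<Rightarrow> 'a::field \<Rightarrow> 'a) \<Rightarrow> ('n \<Rightarrow> 'a) \<Rightarrow> ('n, 'a) mpoly set \<Rightarrow> bool"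
  where
  "extended_derksen_ideal G \<phi> a E \<longleftrightarrow> is_ideal E \<and> E \<noteq> UNIV \<and>
     stable_under G (coeff_action \<phi>) E \<and> derksen_ideal G \<phi> a \<subseteq> E"

text \<open>Monomials are written additively, so \<open>0\<close> is the monomial \<open>1\<close>, and \<open>+\<close> is the product.\<close>

definition monomial_ordering :: "'n monomial rel \<Rightarrow> bool" where
  "monomial_ordering r \<longleftrightarrow> linear_order r \<and> (\<forall>t. (0, t) \<in> r) \<and>
     (\<forall>s t u. (s, t) \<in> r \<longrightarrow> (s + u, t + u) \<in> r)"

text \<open>Only meaningful for \<open>p \<noteq> 0\<close>.\<close>

definition lead_monomial :: "'n monomial rel \<Rightarrow> ('n, 'a::field) mpoly \<Rightarrow> 'n monomial" where
  "lead_monomial r p =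
     (THE m. m \<in> Poly_Mapping.keys p \<and> (\<forall>t\<in>Poly_Mapping.keys p. (t, m) \<in> r))"

definition leading_ideal :: "'n monomial rel \<Rightarrow> ('n, 'a::field) mpoly set \<Rightarrow> ('n, 'a) mpoly set" where
  "leading_ideal r S = ideal_gen {Poly_Mapping.single (lead_monomial r p) 1 | p. p \<in> S \<and> p \<noteq> 0}"

definition groebner_basis ::
    "'n monomial rel \<Rightarrow> ('n, 'a::field) mpoly set \<Rightarrow> ('n, 'a) mpoly set \<Rightarrow> bool" where
  "groebner_basis r E B \<longleftrightarrow> finite B \<and> B \<subseteq> E \<and> leading_ideal r B = leading_ideal r E"

definition monic_mpoly :: "'n monomial rel \<Rightarrow> ('n, 'a::field) mpoly \<Rightarrow> bool" where
  "monic_mpoly r p \<longleftrightarrow> p \<noteq> 0 \<and> Poly_Mapping.lookup p (lead_monomial r p) = 1"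

text \<open>The last condition says that no monomial occurring in \<open>p\<close> is divisible by the leading monomial
  of another element \<open>q\<close>.\<close>

definition reduced_groebner_basis ::
    "'n monomial rel \<Rightarrow> ('n, 'a::field) mpoly set \<Rightarrow> ('n, 'a) mpoly set \<Rightarrow> bool" where
  "reduced_groebner_basis r E B \<longleftrightarrow> groebner_basis r E B \<and> (\<forall>p\<in>B. monic_mpoly r p) \<and>
     (\<forall>p\<in>B. \<forall>q\<in>B. p \<noteq> q \<longrightarrow> (\<forall>t\<in>Poly_Mapping.keys p. \<nexists>u. t = lead_monomial r q + u))"

definition coefficients :: "('n, 'a::field) mpoly set \<Rightarrow> 'a set" where
  "coefficients B = (\<Union>p\<in>B. range (Poly_Mapping.lookup p))"

end

theory Submission
  imports Defs
begin

text \<open>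
  Everything rests on two facts about the reduced Groebner basis \<open>\<G>\<close> of \<open>E\<close>. A nonzero element of
  \<open>E\<close> has a leading monomial that is divisible by the leading monomial of some element of \<open>\<G>\<close>, so
  an element of \<open>E\<close> in which no divisible monomial occurs is zero
  (\<open>ideal_element_irreducible_eq_0\<close>). And dividing by the monic polynomials of \<open>\<G>\<close> needs no
  coefficients outside the ring generated by those of the dividend and of \<open>\<G>\<close>
  (\<open>normal_form_exists\<close>).

  The first fact gives \<open>A \<subseteq> L\<^sup>G\<close>: for \<open>g \<in> \<G>\<close> and \<open>\<sigma> \<in> G\<close> the difference \<open>\<sigma>g - g\<close> lies in the stable
  ideal \<open>E\<close>, its leading terms cancel because \<open>g\<close> is monic, and no other monomial of \<open>g\<close> is divisible
  by a leading monomial because \<open>\<G>\<close> is reduced. So \<open>\<sigma>g = g\<close>.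

  For \<open>R\<^sup>G \<subseteq> A\<close>, write \<open>x \<in> R\<^sup>G\<close> as \<open>x = f(a\<^sub>1, \<dots>, a\<^sub>n)\<close> with \<open>f\<close> over \<open>K\<close>. Since \<open>\<sigma>x = f(\<sigma>a\<^sub>1, \<dots>, \<sigma>a\<^sub>n)\<close>
  and \<open>\<sigma>x = x\<close>, the polynomial \<open>f - x\<close> lies in the Derksen ideal, hence in \<open>E\<close>. So \<open>x\<close> is the normal
  form of \<open>f\<close> (a constant is its own normal form, \<open>E\<close> being proper), and the normal form of \<open>f\<close> has
  coefficients in \<open>A\<close>.

  The statement on localizations follows from these inclusions: if \<open>x \<in> A \<subseteq> R\<^sub>b\<close>, then \<open>x b\<^sup>k \<in> R\<close> for
  some \<open>k\<close>, and this element is invariant because \<open>x\<close> and \<open>b\<close> are.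
\<close>

section \<open>Subrings and localization\<close>

lemma is_subring_hull: "is_subring (is_subring hull S)"
  by (rule hull_in) (auto simp: is_subring_def)

lemma is_subring_subalgebra_gen: "is_subring (subalgebra_gen K S)"
  by (simp add: subalgebra_gen_def is_subring_hull)

lemma subalgebra_gen_superset: "K \<subseteq> subalgebra_gen K S" "S \<subseteq> subalgebra_gen K S"
  using hull_subset[of "K \<union> S" is_subring] by (auto simp: subalgebra_gen_def)

lemma subalgebra_gen_minimal:
  "K \<subseteq> B \<Longrightarrow> S \<subseteq> B \<Longrightarrow> is_subring B \<Longrightarrow> subalgebra_gen K S \<subseteq> B"
  by (simp add: subalgebra_gen_def hull_minimal)

lemma subring_mult: "is_subring B \<Longrightarrow> x \<in> B \<Longrightarrow> y \<in> B \<Longrightarrow> x * y \<in> B"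
  by (simp add: is_subring_def)

lemma subring_power: "is_subring B \<Longrightarrow> x \<in> B \<Longrightarrow> x ^ k \<in> B"
  by (induction k) (auto simp: is_subring_def)

text \<open>The elements that a power of \<open>b\<close> carries into \<open>B\<close> form a subring containing \<open>B\<close> and \<open>1/b\<close>.\<close>

lemma localize_cleared_denominator:
  assumes B: "is_subring B" and b: "b \<in> B" "b \<noteq> 0" and x: "x \<in> localize B b"
  obtains k where "x * b ^ k \<in> B"
proof -
  let ?T = "{x. \<exists>k. x * b ^ k \<in> B}"
  have pow: "b ^ k \<in> B" for k
    using B b(1) by (rule subring_power)
  have "is_subring ?T"
    unfolding is_subring_def
  proof (intro conjI ballI)
    show "0 \<in> ?T" "1 \<in> ?T"
      using B by (auto simp: is_subring_def intro: exI[of _ 0])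
    show "- u \<in> ?T" if "u \<in> ?T" for u
      using that B by (auto simp: is_subring_def)
    fix u v assume "u \<in> ?T" "v \<in> ?T"
    then obtain k l where kl: "u * b ^ k \<in> B" "v * b ^ l \<in> B" by auto
    have "(u + v) * b ^ (k + l) = (u * b ^ k) * b ^ l + (v * b ^ l) * b ^ k"
      by (simp add: power_add algebra_simps)
    moreover have "\<dots> \<in> B"
      using B kl pow by (auto simp: is_subring_def)
    ultimately show "u + v \<in> ?T" by (metis (mono_tags, lifting) mem_Collect_eq)
    have "(u * v) * b ^ (k + l) = (u * b ^ k) * (v * b ^ l)"
      by (simp add: power_add algebra_simps)
    moreover have "\<dots> \<in> B"
      using B kl by (auto simp: is_subring_def)
    ultimately show "u * v \<in> ?T" by (metis (mono_tags, lifting) mem_Collect_eq)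
  qed
  moreover have "B \<subseteq> ?T"
    by (auto intro: exI[of _ 0])
  moreover have "inverse b \<in> ?T"
    using B b by (auto simp: is_subring_def intro!: exI[of _ 1])
  ultimately have "localize B b \<subseteq> ?T"
    unfolding localize_def by (intro subalgebra_gen_minimal) auto
  with x that show thesis by auto
qed

section \<open>Polynomials with coefficients in a subring\<close>

lemma lookup_sum_pm: "Poly_Mapping.lookup (\<Sum>i\<in>I. f i) t = (\<Sum>i\<in>I. Poly_Mapping.lookup (f i) t)"
  by (induction I rule: infinite_finite_induct) (auto simp: lookup_add)

lemma poly_mapping_sum_monomials:
  "(\<Sum>t\<in>Poly_Mapping.keys p. Poly_Mapping.single t (Poly_Mapping.lookup p t)) = p"
  by (rule poly_mapping_eqI) (simp add: lookup_sum_pm lookup_single when_def in_keys_iff)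

lemma subring_sum:
  "is_subring B \<Longrightarrow> (\<And>i. i \<in> I \<Longrightarrow> f i \<in> B) \<Longrightarrow> (\<Sum>i\<in>I. f i) \<in> B"
  by (induction I rule: infinite_finite_induct) (auto simp: is_subring_def)

lemma MConst_add: "MConst (x + y) = MConst x + MConst y"
  and MConst_mult: "MConst (x * y) = MConst x * MConst y"
  and MConst_uminus: "MConst (- x) = - MConst x"
  and MConst_1: "MConst 1 = 1"
  by (simp_all add: MConst_def single_add mult_single single_uminus)

lemma is_subring_polys_over:
  fixes B :: "'l::field set"
  assumes B: "is_subring B"
  shows "is_subring {p :: ('n, 'l) mpoly. range (Poly_Mapping.lookup p) \<subseteq> B}" (is "is_subring ?P")
  unfolding is_subring_def
proof (intro conjI ballI)
  show "0 \<in> ?P" "1 \<in> ?P"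
    using B by (auto simp: is_subring_def lookup_one when_def)
  show "- p \<in> ?P" if "p \<in> ?P" for p
    using that B by (auto simp: is_subring_def)
  fix p q assume pq: "p \<in> ?P" "q \<in> ?P"
  then show "p + q \<in> ?P"
    using B by (auto simp: is_subring_def lookup_add image_subset_iff)
  have "p * q = (\<Sum>s\<in>Poly_Mapping.keys p. Poly_Mapping.single s (Poly_Mapping.lookup p s)) *
      (\<Sum>t\<in>Poly_Mapping.keys q. Poly_Mapping.single t (Poly_Mapping.lookup q t))"
    by (simp only: poly_mapping_sum_monomials)
  also have "\<dots> = (\<Sum>s\<in>Poly_Mapping.keys p. \<Sum>t\<in>Poly_Mapping.keys q.
      Poly_Mapping.single (s + t) (Poly_Mapping.lookup p s * Poly_Mapping.lookup q t))"
    by (simp add: sum_product mult_single)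
  finally have pq_eq: "p * q = \<dots>" .
  have "Poly_Mapping.lookup (p * q) m \<in> B" for m
    unfolding pq_eq lookup_sum_pm
    using pq B
    by (intro subring_sum[OF B]) (auto simp: lookup_single when_def is_subring_def image_subset_iff)
  then show "p * q \<in> ?P" by auto
qed

section \<open>Ideals\<close>

lemmas ideal_0 = module.subspace_0[OF module_times]
  and ideal_add = module.subspace_add[OF module_times]
  and ideal_diff = module.subspace_diff[OF module_times]
  and ideal_uminus = module.subspace_neg[OF module_times]
  and ideal_mult = module.subspace_scale[OF module_times]
  and ideal_ideal_gen = module.subspace_span[OF module_times]
  and ideal_gen_base = module.span_base[OF module_times]
  and ideal_gen_minimal = module.span_minimal[OF module_times]

lemma ideal_cong_mult:
  assumes "is_ideal I" "p - c \<in> I" "q - d \<in> I"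
  shows "p * q - c * d \<in> I"
proof -
  have "p * q - c * d = q * (p - c) + c * (q - d)"
    by (simp add: algebra_simps)
  with assms show ?thesis
    by (simp add: ideal_add ideal_mult)
qed

text \<open>The polynomials in which only multiples of monomials from \<open>M\<close> occur already form an ideal, and it
  contains \<open>M\<close>.\<close>

lemma monomial_ideal_keys:
  fixes M :: "'n monomial set" and p :: "('n, 'l::field) mpoly"
  assumes "p \<in> ideal_gen {Poly_Mapping.single m 1 | m. m \<in> M}" and "t \<in> Poly_Mapping.keys p"
  shows "\<exists>m\<in>M. \<exists>u. t = m + u"
proof -
  let ?I = "{p :: ('n, 'l) mpoly. \<forall>t\<in>Poly_Mapping.keys p. \<exists>m\<in>M. \<exists>u. t = m + u}"
  have "is_ideal ?I"
  proof (rule module.subspaceI[OF module_times])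
    show "0 \<in> ?I" by simp
    show "p + q \<in> ?I" if "p \<in> ?I" "q \<in> ?I" for p q
      using that keys_add[of p q] by blast
    fix c p assume p: "p \<in> ?I"
    show "c * p \<in> ?I"
    proof (intro CollectI ballI)
      fix t assume "t \<in> Poly_Mapping.keys (c * p)"
      then obtain s v where "t = s + v" "v \<in> Poly_Mapping.keys p"
        using keys_mult[of c p] by blast
      moreover from this p obtain m u where "m \<in> M" "v = m + u" by blast
      ultimately have "t = m + (u + s)" by (simp add: ac_simps)
      with \<open>m \<in> M\<close> show "\<exists>m\<in>M. \<exists>u. t = m + u" by blast
    qed
  qed
  moreover have "{Poly_Mapping.single m 1 | m. m \<in> M} \<subseteq> ?I"
    by (force intro: exI[of _ 0])
  ultimately have "ideal_gen {Poly_Mapping.single m 1 | m. m \<in> M} \<subseteq> ?I"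
    by (intro ideal_gen_minimal)
  with assms show ?thesis by blast
qed

section \<open>Monomial orderings are well-founded\<close>

lemma incseq_subsequence_nat:
  fixes f :: "nat \<Rightarrow> nat"
  shows "\<exists>s. strict_mono s \<and> incseq (f \<circ> s)"
proof -
  \<comment> \<open>Let \<open>g n\<close> be an index at or after \<open>n\<close> at which the tail of \<open>f\<close> takes its minimum; the sequence
    jumps from one such index to the next.\<close>
  define g where "g n = (ARG_MIN f i. n \<le> i)" for n
  have g: "n \<le> g n" for n
    unfolding g_def by (rule arg_min_natI[of _ n]) simp
  have g_min: "f (g n) \<le> f i" if "n \<le> i" for n i
    unfolding g_def using that by (rule arg_min_nat_le)
  define s where "s = rec_nat (g 0) (\<lambda>_ i. g (Suc i))"
  have s_Suc: "s (Suc k) = g (Suc (s k))" for k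
    by (simp add: s_def)
  have s_g: "\<exists>n. s k = g n \<and> n \<le> s k" for k
    by (cases k) (auto simp: s_def intro: g exI[of _ 0])
  have "strict_mono s"
    unfolding strict_mono_Suc_iff using g s_Suc by (metis Suc_le_eq)
  moreover have "incseq (f \<circ> s)"
  proof (rule incseq_SucI)
    fix k
    obtain n where "s k = g n" "n \<le> s k" using s_g by blast
    moreover have "s k \<le> s (Suc k)"
      using \<open>strict_mono s\<close> by (simp add: strict_mono_less_eq)
    ultimately show "(f \<circ> s) k \<le> (f \<circ> s) (Suc k)"
      using g_min[of n "s (Suc k)"] by simp
  qed
  ultimately show ?thesis by blast
qed

text \<open>Dickson's lemma, in the form that one subsequence makes all coordinates nondecreasing: the
  coordinates are treated one after the other, passing to a further subsequence each time.\<close>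

lemma incseq_subsequence_coordinates:
  fixes f :: "nat \<Rightarrow> 'i \<Rightarrow> nat"
  assumes "finite I"
  shows "\<exists>s. strict_mono s \<and> (\<forall>i\<in>I. incseq (\<lambda>k. f (s k) i))"
  using assms
proof induction
  case empty
  show ?case using strict_mono_id by blast
next
  case (insert j I)
  then obtain s where s: "strict_mono s" "\<forall>i\<in>I. incseq (\<lambda>k. f (s k) i)" by blast
  obtain s' where s': "strict_mono s'" "incseq ((\<lambda>k. f (s k) j) \<circ> s')"
    using incseq_subsequence_nat by blast
  have "strict_mono (s \<circ> s')"
    using s(1) s'(1) by (rule strict_mono_o)
  moreover have "incseq (\<lambda>k. f ((s \<circ> s') k) i)" if "i \<in> insert j I" for i
    using that s s' by (auto simp: incseq_def strict_mono_less_eq)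
  ultimately show ?case by blast
qed

lemma monomial_sequence_divides:
  fixes f :: "nat \<Rightarrow> 'n::finite monomial"
  shows "\<exists>i j u. i < j \<and> f j = f i + u"
proof -
  obtain s where s: "strict_mono s" "\<And>i. incseq (\<lambda>k. Poly_Mapping.lookup (f (s k)) i)"
    using incseq_subsequence_coordinates[of UNIV "\<lambda>k. Poly_Mapping.lookup (f k)"] by auto
  have "Poly_Mapping.lookup (f (s 0)) i \<le> Poly_Mapping.lookup (f (s 1)) i" for i
    using s(2)[of i] by (simp add: incseq_def)
  then have "f (s 1) = f (s 0) + (f (s 1) - f (s 0))"
    by (intro poly_mapping_eqI) (simp add: lookup_add lookup_minus)
  moreover have "s 0 < s 1"
    using s(1) by (simp add: strict_mono_less)
  ultimately show ?thesis by blast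
qed

text \<open>In a monomial ordering every monomial is at most each of its multiples. An infinite descending
  sequence would therefore contain no monomial that divides a later one, against Dickson's lemma.\<close>

lemma wf_monomial_ordering:
  fixes r :: "'n::finite monomial rel"
  assumes "monomial_ordering r"
  shows "wf (r - Id)"
proof -
  have lin: "linear_order r" and zero: "\<And>t. (0, t) \<in> r"
    and add: "\<And>s t u. (s, t) \<in> r \<Longrightarrow> (s + u, t + u) \<in> r"
    using assms by (auto simp: monomial_ordering_def)
  have tr: "trans r" and anti: "antisym r"
    using lin by (auto simp: order_on_defs)
  have "\<not> (\<forall>i. (f (Suc i), f i) \<in> r - Id)" for f
  proof
    assume f: "\<forall>i. (f (Suc i), f i) \<in> r - Id"
    have less: "(f j, f i) \<in> r - Id" if "i < j" for i j
      using that
    proof (induction j)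
      case (Suc j)
      then show ?case
        using f[rule_format, of j] tr anti by (cases "i = j") (auto dest: transD antisymD)
    qed simp
    obtain i j u where "i < j" "f j = f i + u"
      using monomial_sequence_divides by blast
    moreover have "(f i, f i + u) \<in> r"
      using add[OF zero[of u], of "f i"] by (simp add: add.commute)
    ultimately show False
      using less[of i j] antisymD[OF anti] by (metis Diff_iff IdI)
  qed
  then show ?thesis
    by (simp add: wf_iff_no_infinite_down_chain)
qed

section \<open>Leading monomials and normal forms\<close>

lemma lead_monomial_in_keys:
  fixes p :: "('n, 'l::field) mpoly"
  assumes r: "monomial_ordering r" and "p \<noteq> 0"
  shows "lead_monomial r p \<in> Poly_Mapping.keys p"
    and "\<And>t. t \<in> Poly_Mapping.keys p \<Longrightarrow> (t, lead_monomial r p) \<in> r"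
proof -
  have tr: "trans r" and anti: "antisym r" and tot: "\<And>s t. (s, t) \<in> r \<or> (t, s) \<in> r"
    using r by (auto simp: monomial_ordering_def order_on_defs total_on_def refl_on_def) metis
  have "\<exists>m\<in>S. \<forall>t\<in>S. (t, m) \<in> r" if "finite S" "S \<noteq> {}" for S
    using that
  proof (induction rule: finite_ne_induct)
    case (singleton x)
    then show ?case using tot by auto
  next
    case (insert x S)
    then obtain m where m: "m \<in> S" "\<forall>t\<in>S. (t, m) \<in> r" by blast
    show ?case
    proof (cases "(x, m) \<in> r")
      case True
      with m show ?thesis by blast
    next
      case False
      then have "(m, x) \<in> r" using tot by blast
      with m tot[of x x] show ?thesis using transD[OF tr] by blast
    qed
  qed
  then have "\<exists>m. m \<in> Poly_Mapping.keys p \<and> (\<forall>t\<in>Poly_Mapping.keys p. (t, m) \<in> r)"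
    using \<open>p \<noteq> 0\<close> by (auto simp: Bex_def)
  then have "\<exists>!m. m \<in> Poly_Mapping.keys p \<and> (\<forall>t\<in>Poly_Mapping.keys p. (t, m) \<in> r)"
    using anti by (auto simp: antisym_def)
  from theI'[OF this]
  show "lead_monomial r p \<in> Poly_Mapping.keys p"
    and "\<And>t. t \<in> Poly_Mapping.keys p \<Longrightarrow> (t, lead_monomial r p) \<in> r"
    by (auto simp: lead_monomial_def)
qed

definition reducible :: "'n monomial rel \<Rightarrow> ('n, 'l::field) mpoly set \<Rightarrow> 'n monomial \<Rightarrow> bool" where
  "reducible r B t \<longleftrightarrow> (\<exists>g\<in>B. g \<noteq> 0 \<and> (\<exists>u. t = lead_monomial r g + u))"

text \<open>The leading monomial of a nonzero element of \<open>E\<close> lies in the ideal generated by the leading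
  monomials of \<open>B\<close>, hence is a multiple of one of them.\<close>

lemma ideal_element_irreducible_eq_0:
  fixes E B :: "('n, 'l::field) mpoly set"
  assumes r: "monomial_ordering r" and gb: "groebner_basis r E B" and p: "p \<in> E"
    and irred: "\<And>t. t \<in> Poly_Mapping.keys p \<Longrightarrow> \<not> reducible r B t"
  shows "p = 0"
proof (rule ccontr)
  assume "p \<noteq> 0"
  let ?t = "lead_monomial r p"
  have "Poly_Mapping.single ?t 1 \<in> leading_ideal r E"
    using p \<open>p \<noteq> 0\<close> by (auto simp: leading_ideal_def intro!: ideal_gen_base)
  also have "leading_ideal r E = leading_ideal r B"
    using gb by (simp add: groebner_basis_def)
  also have "\<dots> = ideal_gen {Poly_Mapping.single m 1 | m. m \<in> lead_monomial r ` {g \<in> B. g \<noteq> 0}}"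
    unfolding leading_ideal_def by (intro arg_cong[where f = ideal_gen]) blast
  finally have "\<exists>m\<in>lead_monomial r ` {g \<in> B. g \<noteq> 0}. \<exists>u. ?t = m + u"
    by (rule monomial_ideal_keys) simp
  then have "reducible r B ?t"
    by (auto simp: reducible_def)
  with irred lead_monomial_in_keys(1)[OF r \<open>p \<noteq> 0\<close>] show False by blast
qed

text \<open>Division with remainder. It is enough to reduce the monomials, by well-founded induction: if
  \<open>t\<close> is the leading monomial of \<open>g\<close> times \<open>u\<close>, then \<open>t\<close> is congruent to \<open>t - u g\<close>, in which only
  smaller monomials occur. As \<open>g\<close> is monic, no coefficient has to be inverted.\<close>

lemma normal_form_exists:
  fixes r :: "'n::finite monomial rel" and E B :: "('n, 'l::field) mpoly set"
  assumes r: "monomial_ordering r" and E: "is_ideal E" and "B \<subseteq> E"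
    and monic: "\<And>g. g \<in> B \<Longrightarrow> monic_mpoly r g"
    and C: "is_subring C" "coefficients B \<subseteq> C" and p: "range (Poly_Mapping.lookup p) \<subseteq> C"
  shows "\<exists>h. range (Poly_Mapping.lookup h) \<subseteq> C \<and> p - h \<in> E \<and>
    (\<forall>t\<in>Poly_Mapping.keys h. \<not> reducible r B t)"
proof -
  define N where "N = {p. \<exists>h. range (Poly_Mapping.lookup h) \<subseteq> C \<and> p - h \<in> E \<and>
    (\<forall>t\<in>Poly_Mapping.keys h. \<not> reducible r B t)}"
  have C_simps: "0 \<in> C" "1 \<in> C" "\<And>x y. x \<in> C \<Longrightarrow> y \<in> C \<Longrightarrow> x + y \<in> C"
      "\<And>x y. x \<in> C \<Longrightarrow> y \<in> C \<Longrightarrow> x * y \<in> C" "\<And>x. x \<in> C \<Longrightarrow> - x \<in> C"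
    using C(1) by (auto simp: is_subring_def)
  have N_0: "0 \<in> N"
    unfolding N_def using ideal_0[OF E] C_simps by (auto intro!: exI[of _ 0])
  have N_add: "f + f' \<in> N" if ff': "f \<in> N" "f' \<in> N" for f f'
  proof -
    obtain h h' where h: "range (Poly_Mapping.lookup h) \<subseteq> C" "f - h \<in> E"
        "\<forall>t\<in>Poly_Mapping.keys h. \<not> reducible r B t"
      and h': "range (Poly_Mapping.lookup h') \<subseteq> C" "f' - h' \<in> E"
        "\<forall>t\<in>Poly_Mapping.keys h'. \<not> reducible r B t"
      using ff' unfolding N_def by blast
    have "f + f' - (h + h') = (f - h) + (f' - h')" by simp
    then have "f + f' - (h + h') \<in> E" using h h' E by (simp only: ideal_add)
    moreover have "range (Poly_Mapping.lookup (h + h')) \<subseteq> C"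
      using h h' C_simps by (auto simp: lookup_add image_subset_iff)
    moreover have "\<forall>t\<in>Poly_Mapping.keys (h + h'). \<not> reducible r B t"
      using h h' keys_add[of h h'] by blast
    ultimately show ?thesis unfolding N_def by blast
  qed
  have N_scale: "MConst c * f \<in> N" if c: "c \<in> C" and f: "f \<in> N" for c f
  proof -
    obtain h where h: "range (Poly_Mapping.lookup h) \<subseteq> C" "f - h \<in> E"
        "\<forall>t\<in>Poly_Mapping.keys h. \<not> reducible r B t"
      using f unfolding N_def by blast
    have "MConst c * f - MConst c * h \<in> E"
      using ideal_mult[OF E h(2), of "MConst c"] by (simp add: right_diff_distrib)
    moreover have "range (Poly_Mapping.lookup (MConst c)) \<subseteq> C"
      using c C_simps by (auto simp: MConst_def lookup_single when_def)
    then have "range (Poly_Mapping.lookup (MConst c * h)) \<subseteq> C"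
      using is_subring_polys_over[OF C(1), where 'n = 'n] h(1) unfolding is_subring_def by blast
    moreover have "Poly_Mapping.keys (MConst c * h) \<subseteq> Poly_Mapping.keys h"
      using keys_mult[of "MConst c" h] by (auto simp: MConst_def split: if_splits)
    ultimately show ?thesis using h(3) unfolding N_def by blast
  qed
  have N_sum: "(\<Sum>i\<in>I. f i) \<in> N" if "\<And>i. i \<in> I \<Longrightarrow> f i \<in> N"
    for f :: "'n monomial \<Rightarrow> ('n, 'l) mpoly" and I
    using that by (induction I rule: infinite_finite_induct) (auto intro: N_0 N_add)
  have single_scale: "Poly_Mapping.single t c = MConst c * Poly_Mapping.single t 1"
    for t :: "'n monomial" and c :: 'l
    by (simp add: MConst_def mult_single)
  have N_monomial: "Poly_Mapping.single t 1 \<in> N" for t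
    using wf_monomial_ordering[OF r]
  proof (induction t rule: wf_induct_rule)
    case (less t)
    show ?case
    proof (cases "reducible r B t")
      case False
      have "range (Poly_Mapping.lookup (Poly_Mapping.single t (1::'l))) \<subseteq> C"
        using C_simps by (auto simp: lookup_single when_def)
      with False show ?thesis
        unfolding N_def using ideal_0[OF E] by (auto intro!: exI[of _ "Poly_Mapping.single t 1"])
    next
      case True
      then obtain g u where g: "g \<in> B" "g \<noteq> 0" and t: "t = lead_monomial r g + u"
        by (auto simp: reducible_def)
      define m where "m = lead_monomial r g"
      let ?K = "Poly_Mapping.keys g"
      let ?f = "\<lambda>s. Poly_Mapping.single (s + u) (Poly_Mapping.lookup g s)"
      have m: "m \<in> ?K" and max: "\<And>s. s \<in> ?K \<Longrightarrow> (s, m) \<in> r"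
        using lead_monomial_in_keys[OF r g(2)] by (auto simp: m_def)
      have "Poly_Mapping.single u 1 * g =
          Poly_Mapping.single u 1 * (\<Sum>s\<in>?K. Poly_Mapping.single s (Poly_Mapping.lookup g s))"
        by (simp only: poly_mapping_sum_monomials)
      also have "\<dots> = (\<Sum>s\<in>?K. ?f s)"
        by (simp add: sum_distrib_left mult_single add.commute)
      also have "\<dots> = ?f m + (\<Sum>s\<in>?K - {m}. ?f s)"
        using m by (simp add: sum.remove)
      also have "?f m = Poly_Mapping.single t 1"
        using monic[OF g(1)] by (simp add: monic_mpoly_def m_def t)
      finally have ug: "Poly_Mapping.single u 1 * g =
          Poly_Mapping.single t 1 + (\<Sum>s\<in>?K - {m}. ?f s)" .
      have "?f s \<in> N" if s: "s \<in> ?K - {m}" for s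
      proof -
        have "(s + u, t) \<in> r"
          using max s r by (auto simp: monomial_ordering_def t m_def)
        moreover have "s + u \<noteq> t"
          using s by (simp add: t m_def)
        ultimately have "Poly_Mapping.single (s + u) 1 \<in> N"
          by (intro less.IH) auto
        moreover have "Poly_Mapping.lookup g s \<in> C"
          using g(1) C(2) by (auto simp: coefficients_def)
        ultimately show ?thesis
          by (subst single_scale) (rule N_scale)
      qed
      then have "(\<Sum>s\<in>?K - {m}. ?f s) \<in> N"
        by (rule N_sum)
      then have "MConst (- 1) * (\<Sum>s\<in>?K - {m}. ?f s) \<in> N"
        using C_simps by (intro N_scale) auto
      then have "- (\<Sum>s\<in>?K - {m}. ?f s) \<in> N"
        by (simp add: MConst_uminus MConst_1)
      then obtain h where h: "range (Poly_Mapping.lookup h) \<subseteq> C"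
          "- (\<Sum>s\<in>?K - {m}. ?f s) - h \<in> E" "\<forall>t\<in>Poly_Mapping.keys h. \<not> reducible r B t"
        unfolding N_def by blast
      have "Poly_Mapping.single u 1 * g \<in> E"
        using g(1) \<open>B \<subseteq> E\<close> by (intro ideal_mult[OF E]) auto
      then have "Poly_Mapping.single u 1 * g + (- (\<Sum>s\<in>?K - {m}. ?f s) - h) \<in> E"
        using h(2) by (rule ideal_add[OF E])
      then have "Poly_Mapping.single t 1 - h \<in> E"
        unfolding ug by (simp add: algebra_simps)
      with h show ?thesis unfolding N_def by blast
    qed
  qed
  have "p = (\<Sum>t\<in>Poly_Mapping.keys p. MConst (Poly_Mapping.lookup p t) * Poly_Mapping.single t 1)"
    by (simp add: single_scale[symmetric] poly_mapping_sum_monomials)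
  also have "\<dots> \<in> N"
    using p by (intro N_sum N_scale N_monomial) auto
  finally show ?thesis unfolding N_def by blast
qed

section \<open>Invariance of the reduced Groebner basis\<close>

lemma field_automorphism_action:
  assumes "acts_by_field_automorphisms G \<phi>" "\<sigma> \<in> carrier G"
  shows "\<phi> \<sigma> (x + y) = \<phi> \<sigma> x + \<phi> \<sigma> y" "\<phi> \<sigma> (x * y) = \<phi> \<sigma> x * \<phi> \<sigma> y"
    "\<phi> \<sigma> 0 = 0" "\<phi> \<sigma> 1 = 1" "\<phi> \<sigma> (- x) = - \<phi> \<sigma> x" "\<phi> \<sigma> x = 0 \<longleftrightarrow> x = 0"
proof -
  show add: "\<phi> \<sigma> (x + y) = \<phi> \<sigma> x + \<phi> \<sigma> y" and mult: "\<phi> \<sigma> (x * y) = \<phi> \<sigma> x * \<phi> \<sigma> y" for x y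
    using assms by (auto simp: acts_by_field_automorphisms_def)
  show zero: "\<phi> \<sigma> 0 = 0"
    using add[of 0 0] by (metis add.right_neutral add_left_imp_eq)
  have "inj (\<phi> \<sigma>)"
    using assms group_action.inj_prop[of G UNIV \<phi> \<sigma>]
    by (auto simp: acts_by_field_automorphisms_def)
  then show nz: "\<phi> \<sigma> x = 0 \<longleftrightarrow> x = 0" for x
    using zero by (metis injD)
  show "\<phi> \<sigma> 1 = 1"
    using mult[of 1 1] nz[of 1] by simp
  show "\<phi> \<sigma> (- x) = - \<phi> \<sigma> x"
    using add[of x "- x"] zero by (simp add: eq_neg_iff_add_eq_0 add.commute)
qed

lemma is_subring_invariant_elements:
  assumes act: "acts_by_field_automorphisms G \<phi>" and "is_subring B"
  shows "is_subring (invariant_elements G \<phi> B)"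
  using assms(2) field_automorphism_action[OF act]
  by (auto simp: is_subring_def invariant_elements_def)

text \<open>Acting on coefficients moves neither the monomials of \<open>g\<close> nor its leading coefficient \<open>1\<close>, so
  \<open>\<sigma>g - g\<close> contains only nonleading monomials of \<open>g\<close>, which are irreducible.\<close>

lemma reduced_groebner_basis_fixed:
  fixes r :: "'n monomial rel" and E B :: "('n, 'l::field) mpoly set"
  assumes act: "acts_by_field_automorphisms G \<phi>" and \<sigma>: "\<sigma> \<in> carrier G"
    and r: "monomial_ordering r" and E: "is_ideal E" "stable_under G (coeff_action \<phi>) E"
    and red: "reduced_groebner_basis r E B" and g: "g \<in> B"
  shows "coeff_action \<phi> \<sigma> g = g"
proof -
  note \<phi> = field_automorphism_action[OF act \<sigma>]
  have gb: "groebner_basis r E B" and monic: "monic_mpoly r g"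
    using red g by (auto simp: reduced_groebner_basis_def)
  have lookup: "Poly_Mapping.lookup (coeff_action \<phi> \<sigma> g) t = \<phi> \<sigma> (Poly_Mapping.lookup g t)" for t
    by (simp add: coeff_action_def map.rep_eq when_def \<phi>)
  have gE: "g \<in> E"
    using gb g by (auto simp: groebner_basis_def)
  then have "coeff_action \<phi> \<sigma> g - g \<in> E"
    using E \<sigma> by (intro ideal_diff[OF E(1)]) (auto simp: stable_under_def)
  then have "coeff_action \<phi> \<sigma> g - g = 0"
  proof (rule ideal_element_irreducible_eq_0[OF r gb])
    fix t assume t: "t \<in> Poly_Mapping.keys (coeff_action \<phi> \<sigma> g - g)"
    then have tg: "t \<in> Poly_Mapping.keys g"
      by (auto simp: in_keys_iff lookup_minus lookup \<phi>)
    have t_lead: "t \<noteq> lead_monomial r g"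
      using t monic by (auto simp: in_keys_iff lookup_minus lookup \<phi> monic_mpoly_def)
    show "\<not> reducible r B t"
    proof
      assume "reducible r B t"
      then obtain q u where q: "q \<in> B" "t = lead_monomial r q + u"
        by (auto simp: reducible_def)
      have "\<forall>p\<in>B. \<forall>q\<in>B. p \<noteq> q \<longrightarrow> (\<forall>t\<in>Poly_Mapping.keys p. \<nexists>u. t = lead_monomial r q + u)"
        using red by (simp add: reduced_groebner_basis_def)
      with g q tg have "q = g" by metis
      \<comment> \<open>A multiple of the leading monomial of \<open>g\<close> that occurs in \<open>g\<close> is that monomial itself.\<close>
      have "(0 + lead_monomial r g, u + lead_monomial r g) \<in> r"
        using r unfolding monomial_ordering_def by blast
      then have "(lead_monomial r g, t) \<in> r"
        using q \<open>q = g\<close> by (simp add: add.commute)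
      moreover have "(t, lead_monomial r g) \<in> r"
        using lead_monomial_in_keys(2)[OF r _ tg] monic by (auto simp: monic_mpoly_def)
      ultimately show False
        using t_lead r by (auto simp: monomial_ordering_def order_on_defs antisym_def)
    qed
  qed
  then show ?thesis by simp
qed

section \<open>Invariants and the Derksen ideal\<close>

text \<open>The polynomial \<open>f\<close> expresses \<open>x\<close> in terms of the generators, and \<open>\<phi> \<sigma> x\<close> is its value at the
  translated generators. Stating this as a congruence modulo the ideal of the translated point makes
  the set of all such \<open>x\<close> visibly a subring, which contains the generators.\<close>

lemma subalgebra_element_as_value:
  fixes a :: "'n \<Rightarrow> 'l::field"
  assumes act: "acts_by_field_automorphisms G \<phi>"
    and K: "is_subring K" "K \<subseteq> invariant_elements G \<phi> UNIV"
    and x: "x \<in> subalgebra_gen K (range a)"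
  shows "\<exists>f. range (Poly_Mapping.lookup f) \<subseteq> K \<and> (\<forall>\<sigma>\<in>carrier G.
    f - MConst (\<phi> \<sigma> x) \<in> ideal_gen (range (\<lambda>i. MVar i - MConst (\<phi> \<sigma> (a i)))))"
proof -
  note \<phi> = field_automorphism_action[OF act]
  define J :: "_ \<Rightarrow> ('n, 'l) mpoly set" where
    "J \<sigma> = ideal_gen (range (\<lambda>i. MVar i - MConst (\<phi> \<sigma> (a i))))" for \<sigma>
  have J: "is_ideal (J \<sigma>)" for \<sigma>
    unfolding J_def by (rule ideal_ideal_gen)
  define P :: "('n, 'l) mpoly set" where "P = {f. range (Poly_Mapping.lookup f) \<subseteq> K}"
  have P: "is_subring P"
    unfolding P_def using K(1) by (rule is_subring_polys_over)
  let ?V = "{x. \<exists>f\<in>P. \<forall>\<sigma>\<in>carrier G. f - MConst (\<phi> \<sigma> x) \<in> J \<sigma>}"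
  have K_V: "K \<subseteq> ?V"
  proof
    fix k assume k: "k \<in> K"
    then have "MConst k \<in> P"
      using K(1) by (auto simp: P_def MConst_def lookup_single when_def is_subring_def)
    moreover have "MConst k - MConst (\<phi> \<sigma> k) \<in> J \<sigma>" if "\<sigma> \<in> carrier G" for \<sigma>
      using k K(2) that ideal_0[OF J] by (auto simp: invariant_elements_def)
    ultimately show "k \<in> ?V" by blast
  qed
  have "range a \<subseteq> ?V"
  proof
    fix y assume "y \<in> range a"
    then obtain i where y: "y = a i" by blast
    have "MVar i \<in> P"
      using K(1) by (auto simp: P_def MVar_def lookup_single when_def is_subring_def)
    moreover have "MVar i - MConst (\<phi> \<sigma> y) \<in> J \<sigma>" for \<sigma>
      unfolding J_def y by (intro ideal_gen_base) auto
    ultimately show "y \<in> ?V" by blast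
  qed
  moreover have "is_subring ?V"
    unfolding is_subring_def
  proof (intro conjI ballI)
    show "0 \<in> ?V" "1 \<in> ?V"
      using K_V K(1) unfolding is_subring_def by blast+
  next
    fix y assume "y \<in> ?V"
    then obtain f where f: "f \<in> P" "\<forall>\<sigma>\<in>carrier G. f - MConst (\<phi> \<sigma> y) \<in> J \<sigma>" by blast
    have "- f - MConst (\<phi> \<sigma> (- y)) \<in> J \<sigma>" if "\<sigma> \<in> carrier G" for \<sigma>
      using ideal_uminus[OF J, of "f - MConst (\<phi> \<sigma> y)" \<sigma>] f(2) that
      by (simp add: \<phi> MConst_uminus)
    with f(1) P show "- y \<in> ?V" unfolding is_subring_def by blast
  next
    fix y z assume "y \<in> ?V" "z \<in> ?V"
    then obtain f h where f: "f \<in> P" "\<forall>\<sigma>\<in>carrier G. f - MConst (\<phi> \<sigma> y) \<in> J \<sigma>"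
      and h: "h \<in> P" "\<forall>\<sigma>\<in>carrier G. h - MConst (\<phi> \<sigma> z) \<in> J \<sigma>" by blast
    have "f + h - MConst (\<phi> \<sigma> (y + z)) \<in> J \<sigma>" if "\<sigma> \<in> carrier G" for \<sigma>
      using ideal_add[OF J, of "f - MConst (\<phi> \<sigma> y)" \<sigma> "h - MConst (\<phi> \<sigma> z)"] f(2) h(2) that
      by (simp add: \<phi> MConst_add algebra_simps)
    moreover have "f * h - MConst (\<phi> \<sigma> (y * z)) \<in> J \<sigma>" if "\<sigma> \<in> carrier G" for \<sigma>
      using ideal_cong_mult[OF J] f(2) h(2) that by (simp add: \<phi> MConst_mult)
    ultimately show "y + z \<in> ?V" "y * z \<in> ?V"
      using f(1) h(1) P unfolding is_subring_def by blast+
  qed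
  ultimately have "subalgebra_gen K (range a) \<subseteq> ?V"
    using K_V by (intro subalgebra_gen_minimal)
  with x show ?thesis unfolding P_def J_def by blast
qed

text \<open>An invariant \<open>x\<close> is the value of one polynomial \<open>f\<close> at all the translated points simultaneously,
  so \<open>x\<close> and \<open>f\<close> are congruent modulo the Derksen ideal and have the same normal form.\<close>

lemma invariant_in_coefficient_algebra:
  fixes a :: "'n::finite \<Rightarrow> 'l::field"
  assumes act: "acts_by_field_automorphisms G \<phi>"
    and K: "is_subring K" "K \<subseteq> invariant_elements G \<phi> UNIV"
    and E: "extended_derksen_ideal G \<phi> a E" and r: "monomial_ordering r"
    and gb: "groebner_basis r E B" and monic: "\<And>g. g \<in> B \<Longrightarrow> monic_mpoly r g"
    and x: "x \<in> invariant_elements G \<phi> (subalgebra_gen K (range a))"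
  shows "x \<in> subalgebra_gen K (coefficients B)"
proof -
  let ?A = "subalgebra_gen K (coefficients B)"
  have idE: "is_ideal E" and proper: "E \<noteq> UNIV" and der: "derksen_ideal G \<phi> a \<subseteq> E"
    using E by (auto simp: extended_derksen_ideal_def)
  have BE: "B \<subseteq> E"
    using gb by (simp add: groebner_basis_def)
  obtain f where f: "range (Poly_Mapping.lookup f) \<subseteq> K" "\<forall>\<sigma>\<in>carrier G.
      f - MConst (\<phi> \<sigma> x) \<in> ideal_gen (range (\<lambda>i. MVar i - MConst (\<phi> \<sigma> (a i))))"
    using subalgebra_element_as_value[OF act K] x unfolding invariant_elements_def by blast
  have "f - MConst x \<in> derksen_ideal G \<phi> a"
    using f(2) x by (auto simp: derksen_ideal_def invariant_elements_def)
  then have fx: "f - MConst x \<in> E"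
    using der by blast
  have "range (Poly_Mapping.lookup f) \<subseteq> ?A"
    using f(1) subalgebra_gen_superset(1) by blast
  then obtain h where h: "range (Poly_Mapping.lookup h) \<subseteq> ?A" "f - h \<in> E"
      "\<forall>t\<in>Poly_Mapping.keys h. \<not> reducible r B t"
    using normal_form_exists[OF r idE BE monic is_subring_subalgebra_gen
        subalgebra_gen_superset(2)] by blast
  \<comment> \<open>The monomial \<open>1\<close> is divisible only by \<open>1\<close>, and a monic polynomial with this leading monomial
    is the constant \<open>1\<close>, which a proper ideal does not contain. So the constant \<open>x\<close> is irreducible.\<close>
  have irred_0: "\<not> reducible r B 0"
  proof
    assume "reducible r B 0"
    then obtain g u where g: "g \<in> B" "g \<noteq> 0" "0 = lead_monomial r g + u"
      by (auto simp: reducible_def)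
    have lead: "lead_monomial r g = 0"
    proof (rule poly_mapping_eqI)
      fix i
      have "Poly_Mapping.lookup (lead_monomial r g + u) i = 0"
        using g(3) by (metis lookup_zero)
      then show "Poly_Mapping.lookup (lead_monomial r g) i = Poly_Mapping.lookup 0 i"
        by (simp add: lookup_add)
    qed
    have "t = 0" if "t \<in> Poly_Mapping.keys g" for t
      using lead_monomial_in_keys(2)[OF r g(2) that] r unfolding lead
      by (auto simp: monomial_ordering_def order_on_defs antisym_def)
    moreover have "Poly_Mapping.lookup g 0 = 1"
      using monic[OF g(1)] by (simp add: monic_mpoly_def lead)
    ultimately have "g = 1"
      by (intro poly_mapping_eqI) (auto simp: lookup_one when_def in_keys_iff)
    then have "p \<in> E" for p
      using ideal_mult[OF idE, of g p] g(1) BE by auto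
    with proper show False by auto
  qed
  have "(f - MConst x) - (f - h) \<in> E"
    using fx h(2) by (rule ideal_diff[OF idE])
  then have "h - MConst x \<in> E" by simp
  then have "h - MConst x = 0"
  proof (rule ideal_element_irreducible_eq_0[OF r gb])
    fix t assume "t \<in> Poly_Mapping.keys (h - MConst x)"
    then have "t \<in> Poly_Mapping.keys h \<or> t = 0"
      by (auto simp: in_keys_iff lookup_minus MConst_def lookup_single when_def split: if_splits)
    with h(3) irred_0 show "\<not> reducible r B t" by blast
  qed
  then have "Poly_Mapping.lookup h 0 = x"
    by (simp add: MConst_def)
  with h(1) show ?thesis by blast
qed

section \<open>The coefficient algebra and the invariant ring\<close>

text \<open>If \<open>x \<in> A\<close> becomes an element of \<open>R\<close> after multiplication by a power of \<open>b\<close>, that element is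
  invariant, because \<open>x\<close> and \<open>b\<close> are. So \<open>x\<close> has an invariant numerator over a power of \<open>b\<close>.\<close>

lemma localize_invariants:
  assumes act: "acts_by_field_automorphisms G \<phi>" and R: "is_subring R"
    and A: "invariant_elements G \<phi> R \<subseteq> A" "A \<subseteq> invariant_elements G \<phi> UNIV" "A \<subseteq> localize R b"
    and b: "b \<in> invariant_elements G \<phi> R" "b \<noteq> 0"
  shows "localize (invariant_elements G \<phi> R) b = localize A b"
proof -
  let ?I = "invariant_elements G \<phi> R"
  have ring_loc: "is_subring (localize B b)" and loc: "B \<subseteq> localize B b" "inverse b \<in> localize B b"
    for B
    using subalgebra_gen_superset(1)[of B] subalgebra_gen_superset(2)[of "{inverse b}" B]
    by (auto simp: localize_def is_subring_subalgebra_gen)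
  have bR: "b \<in> R" and b_inv: "b \<in> invariant_elements G \<phi> UNIV"
    using b(1) by (auto simp: invariant_elements_def)
  have ring_inv: "is_subring (invariant_elements G \<phi> UNIV)"
    by (rule is_subring_invariant_elements[OF act]) (simp add: is_subring_def)
  have "A \<subseteq> localize ?I b"
  proof
    fix x assume x: "x \<in> A"
    then obtain k where k: "x * b ^ k \<in> R"
      using localize_cleared_denominator[OF R bR b(2)] A(3) by blast
    have "x * b ^ k \<in> invariant_elements G \<phi> UNIV"
      using x A(2) b_inv by (intro subring_mult[OF ring_inv] subring_power[OF ring_inv]) auto
    with k have "x * b ^ k \<in> ?I"
      by (simp add: invariant_elements_def)
    then have "(x * b ^ k) * inverse b ^ k \<in> localize ?I b"
      by (rule subring_mult[OF ring_loc subsetD[OF loc(1)] subring_power[OF ring_loc loc(2)]])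
    moreover have "(x * b ^ k) * inverse b ^ k = x"
      using b(2) by (simp add: mult.assoc flip: power_mult_distrib)
    ultimately show "x \<in> localize ?I b" by simp
  qed
  then have "localize A b \<subseteq> localize ?I b"
    using loc ring_loc unfolding localize_def[of A] by (intro subalgebra_gen_minimal) auto
  moreover have "localize ?I b \<subseteq> localize A b"
    using A(1) loc[where B = A] ring_loc unfolding localize_def[of ?I]
    by (intro subalgebra_gen_minimal) auto
  ultimately show ?thesis by blast
qed

theorem theorem1p4:
  fixes G :: "('g, 'm) monoid_scheme"
    and \<phi> :: "'g \<Rightarrow> 'l::field \<Rightarrow> 'l"
    and K R A :: "'l set"
    and a :: "'n::finite \<Rightarrow> 'l"
    and E \<G> :: "('n, 'l) mpoly set"
    and r :: "'n monomial rel"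
  assumes "acts_by_field_automorphisms G \<phi>"
    and "is_subring K" and "K \<subseteq> invariant_elements G \<phi> UNIV"
    and "R = subalgebra_gen K (range a)"
    and "stable_under G \<phi> R"
    and "Quot R = UNIV"
    and "extended_derksen_ideal G \<phi> a E"
    and "monomial_ordering r"
    and "reduced_groebner_basis r E \<G>"
    and "A = subalgebra_gen K (coefficients \<G>)"
  shows "invariant_elements G \<phi> R \<subseteq> A \<and> A \<subseteq> invariant_elements G \<phi> UNIV \<and>
    (\<forall>b. b \<in> invariant_elements G \<phi> R \<and> b \<noteq> 0 \<and> A \<subseteq> localize R b \<longrightarrow>
       localize (invariant_elements G \<phi> R) b = localize A b)"
proof -
  note act = assms(1) and r = assms(8) and red = assms(9)
  have gb: "groebner_basis r E \<G>" and monic: "\<And>g. g \<in> \<G> \<Longrightarrow> monic_mpoly r g"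
    using red by (auto simp: reduced_groebner_basis_def)
  have R_A: "invariant_elements G \<phi> R \<subseteq> A"
    using invariant_in_coefficient_algebra[OF act assms(2,3,7) r gb monic]
    unfolding assms(4,10) by blast
  have "Poly_Mapping.lookup g t \<in> invariant_elements G \<phi> UNIV" if g: "g \<in> \<G>" for g t
  proof -
    have "\<phi> \<sigma> (Poly_Mapping.lookup g t) = Poly_Mapping.lookup g t" if \<sigma>: "\<sigma> \<in> carrier G" for \<sigma>
    proof -
      have "coeff_action \<phi> \<sigma> g = g"
        using reduced_groebner_basis_fixed[OF act \<sigma> r _ _ red g] assms(7)
        by (simp add: extended_derksen_ideal_def)
      moreover have "Poly_Mapping.lookup (coeff_action \<phi> \<sigma> g) t = \<phi> \<sigma> (Poly_Mapping.lookup g t)"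
        by (simp add: coeff_action_def map.rep_eq when_def field_automorphism_action[OF act \<sigma>])
      ultimately show ?thesis by simp
    qed
    then show ?thesis by (simp add: invariant_elements_def)
  qed
  then have "coefficients \<G> \<subseteq> invariant_elements G \<phi> UNIV"
    by (auto simp: coefficients_def)
  moreover have "is_subring (invariant_elements G \<phi> UNIV)"
    by (rule is_subring_invariant_elements[OF act]) (simp add: is_subring_def)
  ultimately have A_inv: "A \<subseteq> invariant_elements G \<phi> UNIV"
    unfolding assms(10) using assms(3) by (intro subalgebra_gen_minimal)
  have "is_subring R"
    unfolding assms(4) by (rule is_subring_subalgebra_gen)
  with R_A A_inv show ?thesis
    using localize_invariants[OF act] by blast
qed

end
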